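(* Let $\mathbb G=(\mathcal V,\mathcal E)$ be an undirected graph with node set $\mathcal V=\{1,\dots,N\}$ and Laplacian matrix $L_N$, and let $\mathcal S\subset\mathcal V$ be the set of controlled nodes, with $|\mathcal S|=l$, $1\le l<N$. Then $$\lambda_1(L(\mathcal S|\mathcal S))\le k_{\min},$$ where $k_{\min}$ is the minimal degree (in $\mathbb G$) of the uncontrolled nodes, i.e. of the nodes in $\mathcal V\setminus\mathcal S$.
   Context: Graphs have no self-loops or multiple edges. The Laplacian matrix $L_N=[l_{ij}]_{N\times N}$ of an undirected graph $\mathbb G$ is defined by: for $i\ne j$, $l_{ij}=-1$ if there is an edge between $i$ and $j$ and $l_{ij}=0$ otherwise; $l_{ii}=-\sum_{j\neq i}l_{ij}$. For $\mathcal S\subset\mathcal V$ with $|\mathcal S|=l$, $L(\mathcal S|\mathcal S)$ denotes the $(N-l)\times(N-l)$ principal submatrix of $L_N$ obtained by deleting the rows and columns corresponding to the nodes in $\mathcal S$. For a real symmetric matrix $M$, $\lambda_1(M)$ is its smallest eigenvalue. *)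

theory Defs
  imports
    "Jordan_Normal_Form.Spectral_Radius"
    "Jordan_Normal_Form.DL_Submatrix"
    "Graph_Theory.Pair_Digraph"
begin

(* A simple undirected graph is a pair_graph: finite, loop-free, with a symmetric set of
   arcs in which the edge {i, j} appears as the two pairs (i, j) and (j, i). Hence the
   degree of a node is its out_degree.

   The nodes are {0..<N}, so that a node is also its own row and column index. *)
definition laplacian :: "nat \<Rightarrow> nat pair_pre_digraph \<Rightarrow> real mat" where
  "laplacian N G = (let l = (\<lambda>i j. if (i, j) \<in> parcs G then - 1 else 0) in
     mat N N (\<lambda>(i, j). if i = j then - (\<Sum>k\<in>{0..<N} - {i}. l i k) else l i j))"

definition deleted_submatrix :: "'a mat \<Rightarrow> nat set \<Rightarrow> 'a mat" where
  "deleted_submatrix A S = submatrix A (- S) (- S)"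

(* Used for real symmetric matrices of positive dimension, whose real spectrum is finite
   and nonempty; Min is unspecified otherwise. *)
definition smallest_eigenvalue :: "real mat \<Rightarrow> real" where
  "smallest_eigenvalue M = Min (spectrum M)"

end

theory Submission
  imports Defs
begin

text \<open>
  The degree of a node is the corresponding diagonal entry of the Laplacian, and deleting rows and
  columns does not change the diagonal entries that remain
  (\<open>laplacian_diag\<close>, \<open>deleted_submatrix_diag\<close>). So the bound is an instance of a fact about every
  real symmetric matrix \<open>A\<close>: its smallest eigenvalue is at most each of its diagonal entries
  (\<open>symmetric_has_eigenvalue_le_diag\<close>). This is usually read off the Rayleigh quotient at a unit
  vector; here it is obtained from the growth of matrix powers.

  If \<open>D\<close> is real and symmetric, then \<open>(D\<^sup>2)\<^sub>i\<^sub>i = \<Sum>\<^sub>k D\<^sub>i\<^sub>k\<^sup>2 \<ge> D\<^sub>i\<^sub>i\<^sup>2\<close>. Repeated squaring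
  shows that the powers of \<open>D\<close> are unbounded as soon as \<open>D\<^sub>i\<^sub>i > 1\<close>. A matrix whose spectral radius
  is below 1 has bounded powers, so in that case \<open>D\<^sub>i\<^sub>i \<le> 1\<close>
  (\<open>diag_le_1_if_spectral_radius_less_1\<close>).

  Suppose now that all eigenvalues of \<open>A\<close> exceed \<open>a = A\<^sub>i\<^sub>i\<close>. With \<open>c\<close> above the whole spectrum, the
  eigenvalues of \<open>c I - A\<close> are positive and all smaller than the diagonal entry \<open>c - a\<close>.
  Dividing by a number \<open>r\<close> strictly between the largest of them and \<open>c - a\<close> gives a symmetric matrix with spectrum in \<open>(0, 1)\<close> but
  a diagonal entry above 1, a contradiction. Here the spectral radius is taken over the complex
  numbers, so it matters that a real symmetric matrix has no other complex eigenvalues than its real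
  ones (\<open>complex_spectrum_of_real_symmetric\<close>).
\<close>

section \<open>The spectrum of a real symmetric matrix\<close>

lemma pow_mat_add:
  assumes A: "A \<in> carrier_mat n n"
  shows "A ^\<^sub>m (m + k) = A ^\<^sub>m m * A ^\<^sub>m k"
proof (induct k)
  case 0
  then show ?case using A by (simp add: right_mult_one_mat[OF pow_carrier_mat[OF A]])
next
  case (Suc k)
  have "A ^\<^sub>m m * A ^\<^sub>m k * A = A ^\<^sub>m m * (A ^\<^sub>m k * A)"
    using A by (intro assoc_mult_mat[of _ n n _ n _ n]) auto
  then show ?case using Suc by simp
qed

lemma transpose_pow_mat_of_symmetric:
  fixes A :: "'a :: comm_semiring_1 mat"
  assumes A: "A \<in> carrier_mat n n" and sym: "transpose_mat A = A"
  shows "transpose_mat (A ^\<^sub>m k) = A ^\<^sub>m k"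
proof (induct k)
  case 0
  then show ?case using A by simp
next
  case (Suc k)
  have "transpose_mat (A ^\<^sub>m Suc k) = transpose_mat A * transpose_mat (A ^\<^sub>m k)"
    using transpose_mult[OF pow_carrier_mat[OF A] A] by simp
  also have "\<dots> = A * A ^\<^sub>m k" using Suc sym by simp
  also have "\<dots> = A ^\<^sub>m Suc k"
    using pow_mat_add[OF A, of 1 k] A by simp
  finally show ?case .
qed

text \<open>
  By symmetry the diagonal entry of the square is a sum of squares along row \<open>i\<close>, one of which is
  the square of the diagonal entry.
\<close>

lemma diag_square_le_symmetric_square:
  fixes E :: "real mat"
  assumes E: "E \<in> carrier_mat n n" and sym: "transpose_mat E = E" and i: "i < n"
  shows "(E $$ (i, i))\<^sup>2 \<le> (E * E) $$ (i, i)"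
proof -
  have sw: "E $$ (k, i) = E $$ (i, k)" if "k < n" for k
    using arg_cong[OF sym, of "\<lambda>M. M $$ (i, k)"] E i that by simp
  have "(E * E) $$ (i, i) = (\<Sum>k<n. E $$ (i, k) * E $$ (k, i))"
    using E i by (simp add: scalar_prod_def atLeast0LessThan)
  also have "\<dots> = (\<Sum>k<n. (E $$ (i, k))\<^sup>2)"
    by (intro sum.cong) (auto simp: sw power2_eq_square)
  also have "\<dots> \<ge> (E $$ (i, i))\<^sup>2"
    using i by (intro member_le_sum) auto
  finally show ?thesis .
qed

text \<open>
  Spectral radius below 1 bounds all powers of \<open>D\<close>, whereas a diagonal entry \<open>d > 1\<close> would grow at
  least like \<open>d ^ (2 ^ k)\<close> in the powers \<open>D ^ (2 ^ k)\<close>, since these are symmetric and each is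
  the square of the one before.
\<close>

lemma diag_le_1_if_spectral_radius_less_1:
  fixes D :: "real mat"
  assumes D: "D \<in> carrier_mat n n" and sym: "transpose_mat D = D" and i: "i < n"
    and sr: "spectral_radius (map_mat complex_of_real D) < 1"
  shows "D $$ (i, i) \<le> 1"
proof (rule ccontr)
  assume "\<not> D $$ (i, i) \<le> 1"
  then have gt: "1 < D $$ (i, i)" by simp
  let ?C = "map_mat complex_of_real D"
  have grow: "(D $$ (i, i)) ^ (2 ^ k) \<le> (D ^\<^sub>m (2 ^ k)) $$ (i, i)" for k
  proof (induct k)
    case 0
    then show ?case using D by simp
  next
    case (Suc k)
    have "(D $$ (i, i)) ^ (2 ^ Suc k) = ((D $$ (i, i)) ^ (2 ^ k))\<^sup>2"
      by (simp add: power_mult[symmetric] mult.commute)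
    also have "\<dots> \<le> ((D ^\<^sub>m (2 ^ k)) $$ (i, i))\<^sup>2"
      using Suc gt by (intro power_mono) auto
    also have "\<dots> \<le> (D ^\<^sub>m (2 ^ k) * D ^\<^sub>m (2 ^ k)) $$ (i, i)"
      using D i by (intro diag_square_le_symmetric_square transpose_pow_mat_of_symmetric[OF D sym]) auto
    also have "\<dots> = (D ^\<^sub>m (2 ^ Suc k)) $$ (i, i)"
      by (simp add: pow_mat_add[OF D, symmetric] mult_2)
    finally show ?case .
  qed
  have C: "?C \<in> carrier_mat n n" using D by simp
  obtain c where c: "norm_bound (?C ^\<^sub>m k) c" for k
    using spectral_radius_jnf_norm_bound_less_1_upper_triangular[OF C sr] by blast
  have bound: "(D ^\<^sub>m k) $$ (i, i) \<le> c" for k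
  proof -
    have "norm ((?C ^\<^sub>m k) $$ (i, i)) \<le> c"
      using c[of k] C i unfolding norm_bound_def by simp
    moreover have "(?C ^\<^sub>m k) $$ (i, i) = complex_of_real ((D ^\<^sub>m k) $$ (i, i))"
      using D i by (simp add: of_real_hom.mat_hom_pow[OF D, symmetric])
    ultimately show ?thesis by simp
  qed
  obtain m where m: "c < (D $$ (i, i)) ^ m"
    using real_arch_pow[OF gt] by blast
  have "(D $$ (i, i)) ^ m \<le> (D $$ (i, i)) ^ (2 ^ m)"
    using gt by (intro power_increasing) (auto intro: less_imp_le)
  with grow[of m] bound[of "2 ^ m"] m show False by linarith
qed

text \<open>
  For a complex eigenvector \<open>v\<close>, moving the symmetric matrix across the Hermitian product
  evaluates the same number both as the eigenvalue and as its conjugate, times the nonzero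
  number \<open>v \<bullet>c v\<close>. So the eigenvalue is real, and being a root of the characteristic polynomial
  it is an eigenvalue of the real matrix itself.
\<close>

lemma complex_spectrum_of_real_symmetric:
  fixes A :: "real mat"
  assumes A: "A \<in> carrier_mat n n" and sym: "transpose_mat A = A"
  shows "spectrum (map_mat complex_of_real A) = complex_of_real ` spectrum A"
proof -
  let ?C = "map_mat complex_of_real A"
  have C: "?C \<in> carrier_mat n n" using A by simp
  have char: "poly (char_poly ?C) (complex_of_real x) = complex_of_real (poly (char_poly A) x)" for x
    by (simp add: of_real_hom.char_poly_hom[OF A])
  show ?thesis
  proof (intro equalityI subsetI)
    fix ev
    assume "ev \<in> complex_of_real ` spectrum A"
    then show "ev \<in> spectrum ?C"
      using char by (auto simp: spectrum_root_char_poly[OF A] spectrum_root_char_poly[OF C])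
  next
    fix ev
    assume mem: "ev \<in> spectrum ?C"
    then obtain v where v: "v \<in> carrier_vec n" "v \<noteq> 0\<^sub>v n" "?C *\<^sub>v v = ev \<cdot>\<^sub>v v"
      using C unfolding spectrum_def eigenvalue_def eigenvector_def by auto
    have symC: "transpose_mat ?C = ?C"
      using sym by (metis map_mat_transpose)
    have cv: "conjugate v \<in> carrier_vec n" using v by simp
    have conj: "?C *\<^sub>v conjugate v = conjugate (?C *\<^sub>v v)"
    proof (rule eq_vecI)
      fix j assume "j < dim_vec (conjugate (?C *\<^sub>v v))"
      then have j: "j < n" using A by simp
      show "(?C *\<^sub>v conjugate v) $ j = conjugate (?C *\<^sub>v v) $ j"
        using A j v(1) by (simp add: scalar_prod_def)
    qed (use A in simp)
    have "ev * (v \<bullet>c v) = (?C *\<^sub>v v) \<bullet>c v" using v by simp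
    also have "\<dots> = v \<bullet> (?C *\<^sub>v conjugate v)"
      using transpose_vec_mult_scalar[OF C cv v(1)] symC by simp
    also have "?C *\<^sub>v conjugate v = cnj ev \<cdot>\<^sub>v conjugate v"
      unfolding conj v(3) by (simp add: conjugate_smult_vec)
    also have "v \<bullet> \<dots> = cnj ev * (v \<bullet>c v)" using v by simp
    finally have "ev = cnj ev"
      using conjugate_square_eq_0_vec[OF v(1)] v(2) by simp
    then obtain x where x: "ev = complex_of_real x"
      using Reals_cnj_iff Reals_cases by metis
    with mem char have "x \<in> spectrum A"
      by (simp add: spectrum_root_char_poly[OF A] spectrum_root_char_poly[OF C])
    with x show "ev \<in> complex_of_real ` spectrum A" by blast
  qed
qed

lemma smult_mat_mult_vec:
  fixes A :: "'a :: comm_semiring_1 mat"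
  assumes "A \<in> carrier_mat m n" and "v \<in> carrier_vec n"
  shows "(a \<cdot>\<^sub>m A) *\<^sub>v v = a \<cdot>\<^sub>v (A *\<^sub>v v)"
  using assms by (intro eq_vecI) (auto simp: scalar_prod_def sum_distrib_left mult.assoc)

text \<open>
  If every eigenvalue exceeded the diagonal entry, reflecting the spectrum by
  \<open>x \<mapsto> (c - x) / r\<close> would turn \<open>A\<close> into a symmetric matrix of spectral radius below 1 with a
  diagonal entry above 1.
\<close>

lemma symmetric_has_eigenvalue_le_diag:
  fixes A :: "real mat"
  assumes A: "A \<in> carrier_mat n n" and sym: "transpose_mat A = A" and i: "i < n"
  shows "\<exists>x \<in> spectrum A. x \<le> A $$ (i, i)"
proof (rule ccontr)
  define a where "a = A $$ (i, i)"
  assume "\<not> ?thesis"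
  then have above: "a < x" if "x \<in> spectrum A" for x using that by (force simp: a_def)
  have n: "0 < n" using i by simp
  have fin: "finite (spectrum A)" by (rule card_finite_spectrum(1)[OF A])
  have ne: "spectrum A \<noteq> {}"
    using spectrum_non_empty[of "map_mat complex_of_real A" n] A n
      complex_spectrum_of_real_symmetric[OF A sym] by auto
  define \<mu> where "\<mu> = Min (spectrum A)"
  define c where "c = Max (spectrum A) + 1"
  \<comment> \<open>\<open>r\<close> is the midpoint of \<open>c - \<mu>\<close>, the largest eigenvalue of \<open>c I - A\<close>, and its diagonal entry \<open>c - a\<close>.\<close>
  define r where "r = c - (a + \<mu>) / 2"
  define D where "D = (1 / r) \<cdot>\<^sub>m (c \<cdot>\<^sub>m 1\<^sub>m n - A)"
  have \<mu>: "a < \<mu>" "\<And>x. x \<in> spectrum A \<Longrightarrow> \<mu> \<le> x"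
    using above fin ne by (auto simp: \<mu>_def)
  have c: "x < c" if "x \<in> spectrum A" for x
    using Max_ge[OF fin that] by (simp add: c_def)
  have "\<mu> < c" using c Min_in[OF fin ne] by (simp add: \<mu>_def)
  then have r: "0 < r" "c - \<mu> < r" "r < c - a" using \<mu>(1) by (auto simp: r_def)
  have D: "D \<in> carrier_mat n n" unfolding D_def using A by (intro smult_carrier_mat minus_carrier_mat)
  have symD: "transpose_mat D = D"
  proof (rule eq_matI)
    fix j k assume "j < dim_row D" "k < dim_col D"
    then have jk: "j < n" "k < n" using D by auto
    have "A $$ (k, j) = A $$ (j, k)"
      using arg_cong[OF sym, of "\<lambda>M. M $$ (j, k)"] A jk by simp
    then show "transpose_mat D $$ (j, k) = D $$ (j, k)"
      using A jk by (simp add: D_def)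
  qed (use D in auto)
  have shift: "c - r * y \<in> spectrum A" if y: "y \<in> spectrum D" for y
  proof -
    obtain v where v: "v \<in> carrier_vec n" "v \<noteq> 0\<^sub>v n" "D *\<^sub>v v = y \<cdot>\<^sub>v v"
      using y D unfolding spectrum_def eigenvalue_def eigenvector_def by auto
    have "A *\<^sub>v v = (c - r * y) \<cdot>\<^sub>v v"
    proof (rule eq_vecI)
      fix j assume "j < dim_vec ((c - r * y) \<cdot>\<^sub>v v)"
      then have j: "j < n" using v by simp
      have "(D *\<^sub>v v) $ j = (1 / r) * (c * v $ j - (A *\<^sub>v v) $ j)"
      proof -
        have "D *\<^sub>v v = (1 / r) \<cdot>\<^sub>v ((c \<cdot>\<^sub>m 1\<^sub>m n - A) *\<^sub>v v)"
          unfolding D_def using A v(1) by (intro smult_mat_mult_vec minus_carrier_mat)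
        also have "(c \<cdot>\<^sub>m 1\<^sub>m n - A) *\<^sub>v v = c \<cdot>\<^sub>v v - A *\<^sub>v v"
          using A v(1) by (simp add: minus_mult_distrib_mat_vec[of _ n n] 
            smult_mat_mult_vec[of _ n n])
        finally show ?thesis using A v(1) j by simp
      qed
      then show "(A *\<^sub>v v) $ j = ((c - r * y) \<cdot>\<^sub>v v) $ j"
        using v j r(1) by (simp add: field_simps)
    qed (use A v in auto)
    then show ?thesis
      using v A unfolding spectrum_def eigenvalue_def eigenvector_def by auto
  qed
  have "spectral_radius (map_mat complex_of_real D) < 1"
  proof -
    obtain y where y: "y \<in> spectrum D"
      and sr: "spectral_radius (map_mat complex_of_real D) = \<bar>y\<bar>"
      using spectral_radius_mem_max(1)[of "map_mat complex_of_real D" n] D n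
        complex_spectrum_of_real_symmetric[OF D symD] by auto
    have "\<mu> \<le> c - r * y" "c - r * y < c" using \<mu>(2) c shift[OF y] by auto
    then have "0 < r * y" "r * y < r" using r by linarith+
    then have "0 < y" "y < 1" using r(1) by (auto simp: zero_less_mult_iff)
    then show ?thesis using sr by simp
  qed
  then have "D $$ (i, i) \<le> 1" by (rule diag_le_1_if_spectral_radius_less_1[OF D symD i])
  moreover have "D $$ (i, i) = (c - a) / r" using A i by (simp add: D_def a_def)
  ultimately show False using r by (simp add: field_simps)
qed

section \<open>Degrees on the diagonal of a Laplacian with nodes deleted\<close>

lemma laplacian_carrier [simp]: "laplacian N G \<in> carrier_mat N N"
  by (simp add: laplacian_def Let_def)

lemma laplacian_diag:
  assumes "pair_graph G" and verts: "pverts G = {0..<N}" and i: "i < N"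
  shows "laplacian N G $$ (i, i) = real (out_degree (with_proj G) i)"
proof -
  interpret pair_graph G by fact
  let ?K = "{k \<in> {0..<N} - {i}. (i, k) \<in> parcs G}"
  have "laplacian N G $$ (i, i) = - (\<Sum>k \<in> {0..<N} - {i}. if (i, k) \<in> parcs G then - 1 else 0)"
    using i by (simp add: laplacian_def Let_def)
  also have "\<dots> = real (card ?K)"
    by (simp add: sum.If_cases Int_def)
  also have "card ?K = card (Pair i ` ?K)"
    by (intro card_image[symmetric]) (simp add: inj_on_def)
  also have "Pair i ` ?K = out_arcs (with_proj G) i"
    using in_arcsD2 verts pair_no_loops by (fastforce simp: out_arcs_def)
  finally show ?thesis by (simp add: out_degree_def)
qed

lemma laplacian_symmetric:
  assumes "pair_graph G"
  shows "transpose_mat (laplacian N G) = laplacian N G"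
proof -
  interpret pair_graph G by fact
  have "(j, k) \<in> parcs G \<longleftrightarrow> (k, j) \<in> parcs G" for j k
    using pair_sym_arcs by (auto simp: symmetric_def dest: symD)
  then show ?thesis
    by (intro eq_matI) (auto simp: laplacian_def Let_def)
qed

lemma deleted_submatrix_carrier:
  assumes "A \<in> carrier_mat n n"
  shows "deleted_submatrix A S \<in> carrier_mat (card ({0..<n} - S)) (card ({0..<n} - S))"
proof -
  have "{i. i < n \<and> i \<in> - S} = {0..<n} - S" by auto
  then show ?thesis using assms
    by (intro carrier_matI) (auto simp: deleted_submatrix_def dim_submatrix)
qed

lemma transpose_deleted_submatrix:
  assumes A: "A \<in> carrier_mat n n"
  shows "transpose_mat (deleted_submatrix A S) = deleted_submatrix (transpose_mat A) S"
proof (rule eq_matI)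
  let ?m = "card {i. i < n \<and> i \<in> - S}"
  have pick: "pick (- S) j < n" if "j < ?m" for j using pick_le[OF that] .
  fix j k
  assume "j < dim_row (deleted_submatrix (transpose_mat A) S)"
    "k < dim_col (deleted_submatrix (transpose_mat A) S)"
  then have "j < ?m" "k < ?m" using A by (auto simp: deleted_submatrix_def dim_submatrix)
  then show "transpose_mat (deleted_submatrix A S) $$ (j, k)
      = deleted_submatrix (transpose_mat A) S $$ (j, k)"
    using A pick by (simp add: deleted_submatrix_def dim_submatrix submatrix_index)
qed (use A in \<open>auto simp: deleted_submatrix_def dim_submatrix\<close>)

text \<open>
  A surviving index \<open>v\<close> moves to the position given by the number of surviving indices below it, the
  same one for its row and its column, so its diagonal entry stays on the diagonal.
\<close>

lemma deleted_submatrix_diag: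
  assumes A: "A \<in> carrier_mat n n" and v: "v \<in> {0..<n} - S"
  shows "\<exists>i < card ({0..<n} - S). deleted_submatrix A S $$ (i, i) = A $$ (v, v)"
proof -
  let ?P = "{a \<in> - S. a < v}"
  have "?P \<subseteq> {0..<n} - S" "v \<in> {0..<n} - S" "v \<notin> ?P" using v by auto
  then have "?P \<subset> {0..<n} - S" by blast
  then have "card ?P < card ({0..<n} - S)" by (intro psubset_card_mono) simp_all
  moreover have "deleted_submatrix A S $$ (card ?P, card ?P) = A $$ (v, v)"
    unfolding deleted_submatrix_def using A v by (intro submatrix_index_card) auto
  ultimately show ?thesis by blast
qed

theorem theorem6:
  fixes G :: "nat pair_pre_digraph" and S :: "nat set" and N l :: nat
  assumes "pair_graph G"
    and "pverts G = {0..<N}"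
    and "S \<subseteq> pverts G"
    and "card S = l"
    and "1 \<le> l" and "l < N"
  shows "smallest_eigenvalue (deleted_submatrix (laplacian N G) S)
    \<le> real (Min (out_degree (with_proj G) ` (pverts G - S)))"
proof -
  let ?deg = "out_degree (with_proj G)"
  let ?M = "deleted_submatrix (laplacian N G) S"
  have "pverts G - S \<noteq> {}"
  proof
    assume "pverts G - S = {}"
    then have "S = {0..<N}" using assms by auto
    then show False using assms by simp
  qed
  then have "Min (?deg ` (pverts G - S)) \<in> ?deg ` (pverts G - S)"
    using assms(2) by (intro Min_in) auto
  then obtain v where v: "v \<in> {0..<N} - S"
    and min: "Min (?deg ` (pverts G - S)) = ?deg v"
    using assms(2) by auto
  obtain i where i: "i < card ({0..<N} - S)"
    and diag: "?M $$ (i, i) = laplacian N G $$ (v, v)"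
    using deleted_submatrix_diag[OF laplacian_carrier v] by blast
  have M: "?M \<in> carrier_mat (card ({0..<N} - S)) (card ({0..<N} - S))"
    by (rule deleted_submatrix_carrier) simp
  have "transpose_mat ?M = ?M"
    using transpose_deleted_submatrix[OF laplacian_carrier] laplacian_symmetric[OF assms(1)]
    by metis
  from symmetric_has_eigenvalue_le_diag[OF M this i]
  obtain x where x: "x \<in> spectrum ?M" "x \<le> ?M $$ (i, i)" by blast
  have "smallest_eigenvalue ?M \<le> x"
    unfolding smallest_eigenvalue_def using card_finite_spectrum(1)[OF M] x(1) by simp
  also have "\<dots> \<le> real (?deg v)"
    using x(2) diag laplacian_diag[OF assms(1,2)] v by simp
  finally show ?thesis using min by simp
qed

end
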